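(* Let $F$ be a field of characteristic zero and let $Q$ be a finite acyclic quiver. Let $m-1$ be the maximal length of a path in $Q$. Then $$\operatorname{Id}(FQ)=\langle\, [x_1,x_2][x_3,x_4]\cdots[x_{2m-1},x_{2m}]\,\rangle_T .$$
   Context: A finite quiver $Q=(Q_0,Q_1,s,t)$ consists of a finite set $Q_0$ of vertices, a finite set $Q_1$ of arrows and maps $s,t:Q_1\to Q_0$ giving the starting and terminal vertex of each arrow. A path of length $r\ge 1$ is a sequence $\alpha_1\alpha_2\cdots\alpha_r$ of arrows with $t(\alpha_i)=s(\alpha_{i+1})$; for each vertex $v$ there is also a lazy path $e_v$ of length $0$ from $v$ to $v$. The quiver is acyclic if it has no path of length $\ge 1$ whose starting and terminal vertices coincide. The path algebra $FQ$ is the $F$-vector space with basis all paths in $Q$ (including lazy paths), with multiplication of paths given by concatenation $pq$ if $t(p)=s(q)$ and $0$ otherwise. $F\langle X\rangle$ is the free associative algebra on countably many non-commuting variables $X=\{x_1,x_2,\dots\}$. For an $F$-algebra $A$, $\operatorname{Id}(A)\subseteq F\langle X\rangle$ is the set of polynomials $f(x_1,\dots,x_N)$ such that $f(a_1,\dots,a_N)=0$ for all $a_1,\dots,a_N\in A$. A T-ideal is a two-sided ideal of $F\langle X\rangle$ stable under all algebra endomorphisms of $F\langle X\rangle$; $\langle Y\rangle_T$ is the smallest T-ideal containing $Y$. $[a,b]=ab-ba$. *)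

theory Defs
  imports
    "HOL-Algebra.Module"
    "HOL-Library.Poly_Mapping"
    "Graph_Theory.Arc_Walk"
begin

section \<open>Quivers and path algebras\<close>

text \<open>
  A quiver is a directed multigraph (parallel arcs and loops are allowed), \<open>tail\<close> and \<open>head\<close> being
  the starting and terminal vertex of an arrow. A path is stored as \<open>(u, p, v)\<close>: starting vertex,
  list of arrows, terminal vertex. The lazy path at \<open>v\<close> is \<open>(v, [], v)\<close>; for \<open>p \<noteq> []\<close> the vertices
  are determined by \<open>p\<close>.
\<close>

type_synonym ('v, 'e) quiver_path = "'v \<times> 'e list \<times> 'v"

definition quiver_paths :: "('v, 'e) pre_digraph \<Rightarrow> ('v, 'e) quiver_path set" where
  "quiver_paths Q = {(u, p, v). pre_digraph.awalk Q u p v}"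

definition path_source :: "('v, 'e) quiver_path \<Rightarrow> 'v" where
  "path_source = (\<lambda>(u, p, v). u)"

definition path_target :: "('v, 'e) quiver_path \<Rightarrow> 'v" where
  "path_target = (\<lambda>(u, p, v). v)"

definition path_length :: "('v, 'e) quiver_path \<Rightarrow> nat" where
  "path_length = (\<lambda>(u, p, v). length p)"

definition path_concat ::
  "('v, 'e) quiver_path \<Rightarrow> ('v, 'e) quiver_path \<Rightarrow> ('v, 'e) quiver_path" where
  "path_concat = (\<lambda>(u, p, v) (u', q, w). (u, p @ q, w))"

definition acyclic_quiver :: "('v, 'e) pre_digraph \<Rightarrow> bool" where
  "acyclic_quiver Q \<longleftrightarrow>
     \<not> (\<exists>p \<in> quiver_paths Q. path_length p \<ge> 1 \<and> path_source p = path_target p)"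

definition is_max_path_length :: "('v, 'e) pre_digraph \<Rightarrow> nat \<Rightarrow> bool" where
  "is_max_path_length Q l \<longleftrightarrow>
     (\<exists>p \<in> quiver_paths Q. path_length p = l) \<and> (\<forall>p \<in> quiver_paths Q. path_length p \<le> l)"

definition path_mult ::
  "(('v, 'e) quiver_path \<Rightarrow>\<^sub>0 'f::field) \<Rightarrow> (('v, 'e) quiver_path \<Rightarrow>\<^sub>0 'f) \<Rightarrow>
   (('v, 'e) quiver_path \<Rightarrow>\<^sub>0 'f)" where
  "path_mult f g =
     (\<Sum>p \<in> Poly_Mapping.keys f. \<Sum>q \<in> Poly_Mapping.keys g.
        if path_target p = path_source q
        then Poly_Mapping.single (path_concat p q) (Poly_Mapping.lookup f p * Poly_Mapping.lookup g q)
        else 0)"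

definition path_algebra ::
  "('v, 'e) pre_digraph \<Rightarrow> ('f::field, ('v, 'e) quiver_path \<Rightarrow>\<^sub>0 'f) module" where
  "path_algebra Q =
     \<lparr> carrier = {f. Poly_Mapping.keys f \<subseteq> quiver_paths Q},
       monoid.mult = path_mult,
       one = (\<Sum>v \<in> verts Q. Poly_Mapping.single (v, [], v) 1),
       zero = 0,
       add = (+),
       smult = (\<lambda>c. Poly_Mapping.map ((*) c)) \<rparr>"

text \<open>
  For a finite quiver this is a ring; in particular the sums over \<open>path_algebra Q\<close> used below to
  evaluate polynomials are meaningful.
\<close>

lemma path_mult_alt:
  assumes "finite P" "finite R" "Poly_Mapping.keys f \<subseteq> P" "Poly_Mapping.keys g \<subseteq> R"
  shows "path_mult f g = (\<Sum>p \<in> P. \<Sum>q \<in> R. if path_target p = path_source q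
     then Poly_Mapping.single (path_concat p q) (Poly_Mapping.lookup f p * Poly_Mapping.lookup g q) else 0)"
proof -
  have "path_mult f g = (\<Sum>p \<in> P. \<Sum>q \<in> Poly_Mapping.keys g. if path_target p = path_source q
     then Poly_Mapping.single (path_concat p q) (Poly_Mapping.lookup f p * Poly_Mapping.lookup g q) else 0)"
    unfolding path_mult_def
    by (rule sum.mono_neutral_left) (use assms in \<open>auto simp: in_keys_iff intro!: sum.neutral\<close>)
  also have "\<dots> = (\<Sum>p \<in> P. \<Sum>q \<in> R. if path_target p = path_source q
     then Poly_Mapping.single (path_concat p q) (Poly_Mapping.lookup f p * Poly_Mapping.lookup g q) else 0)"
    by (intro sum.cong refl sum.mono_neutral_left) (use assms in \<open>auto simp: in_keys_iff\<close>)
  finally show ?thesis .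
qed

lemma path_mult_add_left: "path_mult (f + g) h = path_mult f h + path_mult g h"
proof -
  let ?P = "Poly_Mapping.keys f \<union> Poly_Mapping.keys g \<union> Poly_Mapping.keys (f+g)"
  let ?R = "Poly_Mapping.keys h"
  show ?thesis
    by (subst (1 2 3) path_mult_alt[of ?P ?R])
       (auto simp: sum.distrib[symmetric] lookup_add distrib_right single_add intro!: sum.cong)
qed

lemma path_mult_add_right: "path_mult h (f + g) = path_mult h f + path_mult h g"
proof -
  let ?P = "Poly_Mapping.keys f \<union> Poly_Mapping.keys g \<union> Poly_Mapping.keys (f+g)"
  let ?R = "Poly_Mapping.keys h"
  show ?thesis
    by (subst (1 2 3) path_mult_alt[of ?R ?P])
       (auto simp: sum.distrib[symmetric] lookup_add distrib_left single_add intro!: sum.cong)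
qed

lemma path_mult_zero_simps [simp]: "path_mult 0 f = 0" "path_mult f 0 = 0"
  by (simp_all add: path_mult_def)

lemma path_mult_sum_left: "path_mult (\<Sum>i\<in>A. f i) h = (\<Sum>i\<in>A. path_mult (f i) h)"
  by (induction A rule: infinite_finite_induct) (auto simp: path_mult_add_left)

lemma path_mult_sum_right: "path_mult h (\<Sum>i\<in>A. f i) = (\<Sum>i\<in>A. path_mult h (f i))"
  by (induction A rule: infinite_finite_induct) (auto simp: path_mult_add_right)

lemma path_mult_single:
  "path_mult (Poly_Mapping.single p a) (Poly_Mapping.single q b) =
     (if path_target p = path_source q then Poly_Mapping.single (path_concat p q) (a * b) else 0)"
  by (auto simp: path_mult_def)

lemma poly_mapping_sum_singles: "(\<Sum>p\<in>Poly_Mapping.keys f. Poly_Mapping.single p (Poly_Mapping.lookup f p)) = f"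
  by (rule poly_mapping_eqI) (auto simp: lookup_sum lookup_single when_def in_keys_iff)

lemma poly_mapping_single_induct:
  fixes f :: "'a \<Rightarrow>\<^sub>0 'b::comm_monoid_add"
  assumes "P 0" "\<And>p c. P (Poly_Mapping.single p c)" "\<And>f g. P f \<Longrightarrow> P g \<Longrightarrow> P (f + g)"
  shows "P f"
proof -
  have "P (\<Sum>p\<in>A. Poly_Mapping.single p (Poly_Mapping.lookup f p))" for A
    by (induction A rule: infinite_finite_induct) (auto intro: assms)
  then show ?thesis using poly_mapping_sum_singles by metis
qed

lemma path_mult_assoc: "path_mult (path_mult f g) h = path_mult f (path_mult g h)"
proof (induction f rule: poly_mapping_single_induct)
  case (2 p a)
  show ?case
  proof (induction g rule: poly_mapping_single_induct)
    case (2 q b)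
    show ?case
    proof (induction h rule: poly_mapping_single_induct)
      case (2 r c)
      show ?case
        by (auto simp: path_mult_single path_concat_def path_source_def path_target_def mult.assoc split: prod.splits)
    qed (auto simp: path_mult_add_right path_mult_add_left)
  qed (auto simp: path_mult_add_right path_mult_add_left)
qed (auto simp: path_mult_add_right path_mult_add_left)

lemma path_mult_carrier:
  assumes "Poly_Mapping.keys f \<subseteq> quiver_paths Q" "Poly_Mapping.keys g \<subseteq> quiver_paths Q"
   "wf_digraph Q"
  shows "Poly_Mapping.keys (path_mult f g) \<subseteq> quiver_paths Q"
proof -
  interpret wf_digraph Q by fact
  have *: "path_concat p q \<in> quiver_paths Q" if "p \<in> quiver_paths Q" "q \<in> quiver_paths Q"
     "path_target p = path_source q" for p q
    using that by (auto simp: quiver_paths_def path_concat_def path_target_def path_source_def intro: awalk_appendI)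
  show ?thesis unfolding path_mult_def
    by (intro order.trans[OF keys_sum] UN_least) (use * assms(1,2) in \<open>force split: if_splits\<close>)
qed

lemma one_path_mult:
  assumes "Poly_Mapping.keys f \<subseteq> quiver_paths Q" "finite (verts Q)" "wf_digraph Q"
  shows "path_mult (\<Sum>v\<in>verts Q. Poly_Mapping.single (v, [], v) 1) f = f" (is "path_mult ?e f = f")
    and "path_mult f (\<Sum>v\<in>verts Q. Poly_Mapping.single (v, [], v) 1) = f"
proof -
  interpret wf_digraph Q by fact
  have A: "path_source p \<in> verts Q" "path_target p \<in> verts Q" if "p \<in> Poly_Mapping.keys f" for p
    using that assms(1) by (fastforce simp: quiver_paths_def path_source_def path_target_def)+
  have e1: "path_mult ?e (Poly_Mapping.single p c) = Poly_Mapping.single p c"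
    if "path_source p \<in> verts Q" for p c
  proof -
    have "path_mult ?e (Poly_Mapping.single p c) =
        (\<Sum>v\<in>verts Q. if v = path_source p then Poly_Mapping.single p c else 0)"
      unfolding path_mult_sum_left path_mult_single
      by (rule sum.cong) (auto simp: path_source_def path_target_def path_concat_def split: prod.splits)
    then show ?thesis using that assms(2) by simp
  qed
  have e2: "path_mult (Poly_Mapping.single p c) ?e = Poly_Mapping.single p c"
    if "path_target p \<in> verts Q" for p c
  proof -
    have "path_mult (Poly_Mapping.single p c) ?e =
        (\<Sum>v\<in>verts Q. if v = path_target p then Poly_Mapping.single p c else 0)"
      unfolding path_mult_sum_right path_mult_single
      by (rule sum.cong) (auto simp: path_source_def path_target_def path_concat_def split: prod.splits)
    then show ?thesis using that assms(2) by simp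
  qed
  have "path_mult ?e (\<Sum>p\<in>Poly_Mapping.keys f. Poly_Mapping.single p (Poly_Mapping.lookup f p)) =
    (\<Sum>p\<in>Poly_Mapping.keys f. Poly_Mapping.single p (Poly_Mapping.lookup f p))"
    unfolding path_mult_sum_right by (rule sum.cong) (simp_all add: e1 A)
  then show "path_mult ?e f = f" by (simp add: poly_mapping_sum_singles)
  have "path_mult (\<Sum>p\<in>Poly_Mapping.keys f. Poly_Mapping.single p (Poly_Mapping.lookup f p)) ?e =
    (\<Sum>p\<in>Poly_Mapping.keys f. Poly_Mapping.single p (Poly_Mapping.lookup f p))"
    unfolding path_mult_sum_left by (rule sum.cong) (simp_all add: e2 A)
  then show "path_mult f ?e = f" by (simp add: poly_mapping_sum_singles)
qed

lemma ring_path_algebra: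
  fixes Q :: "('v, 'e) pre_digraph"
  assumes "fin_digraph Q"
  shows "ring (path_algebra Q :: ('f::field, ('v, 'e) quiver_path \<Rightarrow>\<^sub>0 'f) module)" (is "ring ?A")
proof -
  interpret fin_digraph Q by fact
  have k1: "Poly_Mapping.keys (\<Sum>v\<in>verts Q. Poly_Mapping.single (v, [], v) (1::'f)) \<subseteq> quiver_paths Q"
    by (rule order.trans[OF keys_sum]) (auto simp: quiver_paths_def awalk_Nil_iff)
  have k2: "Poly_Mapping.keys (f + g) \<subseteq> quiver_paths Q"
    if "Poly_Mapping.keys f \<subseteq> quiver_paths Q" "Poly_Mapping.keys g \<subseteq> quiver_paths Q"
    for f g :: "('v, 'e) quiver_path \<Rightarrow>\<^sub>0 'f"
    using that keys_add[of f g] by blast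
  have "\<exists>y\<in>carrier ?A. y \<oplus>\<^bsub>?A\<^esub> x = \<zero>\<^bsub>?A\<^esub>" if "x \<in> carrier ?A" for x
    using that by (intro bexI[of _ "-x"]) (auto simp: path_algebra_def)
  then have "abelian_group ?A"
    by (intro abelian_groupI) (simp_all add: path_algebra_def k2 add_ac)
  moreover have "monoid ?A"
    using k1 by (intro monoidI)
      (simp_all add: path_algebra_def path_mult_carrier path_mult_assoc one_path_mult wf_digraph)
  ultimately show ?thesis
    by (rule ringI) (simp_all add: path_algebra_def path_mult_add_left path_mult_add_right)
qed


section \<open>The free associative algebra\<close>

text \<open>
  A copy of the free monoid on \<open>nat\<close>, written additively so that \<open>nc_word \<Rightarrow>\<^sub>0 'f\<close> with the
  convolution product of \<open>Poly_Mapping\<close> is the (unital) free associative algebra. The letter \<open>i\<close>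
  stands for the variable usually numbered \<open>i + 1\<close>.
\<close>

datatype nc_word = NC_Word (letters: "nat list")

instantiation nc_word :: monoid_add
begin

definition zero_nc_word :: nc_word where
  "0 = NC_Word []"

definition plus_nc_word :: "nc_word \<Rightarrow> nc_word \<Rightarrow> nc_word" where
  "v + w = NC_Word (letters v @ letters w)"

instance
  by standard (simp_all add: zero_nc_word_def plus_nc_word_def)

end

type_synonym 'f free_algebra = "nc_word \<Rightarrow>\<^sub>0 'f"

definition nc_var :: "nat \<Rightarrow> 'f::field free_algebra" where
  "nc_var i = Poly_Mapping.single (NC_Word [i]) 1"

definition commutator :: "'r::ring \<Rightarrow> 'r \<Rightarrow> 'r" where
  "commutator a b = a * b - b * a"

definition commutator_product :: "nat \<Rightarrow> 'f::field free_algebra" where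
  "commutator_product m =
     prod_list (map (\<lambda>i. commutator (nc_var (2 * i)) (nc_var (2 * i + 1))) [0..<m])"


section \<open>T-ideals and polynomial identities\<close>

definition algebra_endomorphism :: "('f::field free_algebra \<Rightarrow> 'f free_algebra) \<Rightarrow> bool" where
  "algebra_endomorphism \<phi> \<longleftrightarrow>
     (\<forall>f g. \<phi> (f + g) = \<phi> f + \<phi> g) \<and>
     (\<forall>f g. \<phi> (f * g) = \<phi> f * \<phi> g) \<and>
     (\<forall>c f. \<phi> (Poly_Mapping.map ((*) c) f) = Poly_Mapping.map ((*) c) (\<phi> f)) \<and>
     \<phi> 1 = 1"

text \<open>
  Closure under scalar multiples and negation is implied by closure under multiplication with
  arbitrary elements of the unital free algebra.
\<close>

definition T_ideal :: "'f::field free_algebra set \<Rightarrow> bool" where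
  "T_ideal I \<longleftrightarrow>
     0 \<in> I \<and>
     (\<forall>f \<in> I. \<forall>g \<in> I. f + g \<in> I) \<and>
     (\<forall>f \<in> I. \<forall>g. f * g \<in> I \<and> g * f \<in> I) \<and>
     (\<forall>\<phi>. algebra_endomorphism \<phi> \<longrightarrow> \<phi> ` I \<subseteq> I)"

definition T_ideal_generated :: "'f::field free_algebra set \<Rightarrow> 'f free_algebra set" where
  "T_ideal_generated Y = \<Inter>{I. T_ideal I \<and> Y \<subseteq> I}"

definition eval_word :: "('f, 'a, 'x) module_scheme \<Rightarrow> (nat \<Rightarrow> 'a) \<Rightarrow> nc_word \<Rightarrow> 'a" where
  "eval_word A a w = foldr (\<lambda>i r. a i \<otimes>\<^bsub>A\<^esub> r) (letters w) \<one>\<^bsub>A\<^esub>"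

definition eval_poly ::
  "('f::field, 'a, 'x) module_scheme \<Rightarrow> (nat \<Rightarrow> 'a) \<Rightarrow> 'f free_algebra \<Rightarrow> 'a" where
  "eval_poly A a f =
     (\<Oplus>\<^bsub>A\<^esub>w \<in> Poly_Mapping.keys f. Poly_Mapping.lookup f w \<odot>\<^bsub>A\<^esub> eval_word A a w)"

definition poly_identities :: "('f::field, 'a, 'x) module_scheme \<Rightarrow> 'f free_algebra set" where
  "poly_identities A = {f. \<forall>a. (\<forall>i. a i \<in> carrier A) \<longrightarrow> eval_poly A a f = \<zero>\<^bsub>A\<^esub>}"

end

(*
  The product of m commutators vanishes on FQ because commutators in FQ have no lazy component and
  every path has length less than m. For the converse, the lazy paths and arrows along a path of
  length m - 1 (its vertices are distinct, by acyclicity) make the coefficients of an evaluation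
  into generic upper triangular matrix entries. Sorting the letters of a word from left to right
  gives, for every polynomial f,
    f = sorted part of f + sum over (M, i) of (sorted(M) x_i - sorted(M x_i)) D_(M,i) f,
  where D_(M,i) are Fox derivatives with coefficients in the commutative polynomial ring. If f is
  an identity, the sorted part is zero and every D_(M,i) f vanishes along the path shortened by its
  first arrow. As each factor sorted(M) x_i - sorted(M x_i) is in the commutator ideal, induction on
  the length of the path puts f into the T-ideal. To keep the induction free of products of ideals,
  it runs over left ideals I, passing from I to {s. [x, y] s in I for all x, y}.
*)
theory Submission
  imports Defs "HOL-Library.Multiset"
begin

section \<open>Left ideals of a ring and their commutator quotients\<close>

definition left_ideal_set :: "'r::ring_1 set \<Rightarrow> bool" where
  "left_ideal_set I \<longleftrightarrow> 0 \<in> I \<and> (\<forall>x\<in>I. \<forall>y\<in>I. x + y \<in> I) \<and> (\<forall>r. \<forall>x\<in>I. r * x \<in> I)"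

lemma left_ideal_setD:
  assumes "left_ideal_set I"
  shows "0 \<in> I" "x \<in> I \<Longrightarrow> y \<in> I \<Longrightarrow> x + y \<in> I" "x \<in> I \<Longrightarrow> r * x \<in> I"
    "x \<in> I \<Longrightarrow> y \<in> I \<Longrightarrow> x - y \<in> I"
proof -
  show *: "0 \<in> I" "x \<in> I \<Longrightarrow> y \<in> I \<Longrightarrow> x + y \<in> I" "x \<in> I \<Longrightarrow> r * x \<in> I" for x y r
    using assms by (auto simp: left_ideal_set_def)
  show "x - y \<in> I" if "x \<in> I" "y \<in> I"
    using *(2)[OF that(1) *(3)[OF that(2), of "-1"]] by simp
qed

lemma left_ideal_set_sum:
  assumes "left_ideal_set I" "\<And>x. x \<in> A \<Longrightarrow> f x \<in> I"
  shows "sum f A \<in> I"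
  using assms(2)
  by (induction A rule: infinite_finite_induct) (auto intro: left_ideal_setD[OF assms(1)])

text \<open>Takes the place of dividing \<open>I\<close> by the commutator ideal: the n-fold iterate
  holds those \<open>s\<close> that every product of n commutators carries into
  \<open>I\<close>.\<close>

definition commutator_quotient :: "'r::ring_1 set \<Rightarrow> 'r set" where
  "commutator_quotient I = {s. \<forall>x y. commutator x y * s \<in> I}"

lemma commutator_quotientD: "s \<in> commutator_quotient I \<Longrightarrow> commutator x y * s \<in> I"
  by (simp add: commutator_quotient_def)

text \<open>Stability under left multiplication rests on
  \<open>[x, y] r = [x, y r] - y [x, r]\<close>, which absorbs the factor \<open>r\<close> into
  commutators.\<close>

lemma left_ideal_set_commutator_quotient:
  assumes "left_ideal_set I"
  shows "left_ideal_set (commutator_quotient I)"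
proof -
  note I = left_ideal_setD[OF assms]
  have "commutator x y * (r * s) \<in> I" if "s \<in> commutator_quotient I" for x y r s
  proof -
    have "commutator x y * (r * s) = commutator x (y * r) * s - y * (commutator x r * s)"
      by (simp add: commutator_def algebra_simps)
    then show ?thesis
      using that I(3,4) by (simp add: commutator_quotientD)
  qed
  then show ?thesis
    using I(1,2) by (auto simp: left_ideal_set_def commutator_quotient_def distrib_left)
qed

lemma funpow_commutator_quotient_UNIV:
  assumes "left_ideal_set I"
    and "\<And>a b r. prod_list (map (\<lambda>i. commutator (a i) (b i)) [0..<m]) * r \<in> I"
  shows "(commutator_quotient ^^ m) I = UNIV"
proof -
  have "s \<in> (commutator_quotient ^^ n) I"
    if "\<And>a b. prod_list (map (\<lambda>i. commutator (a i) (b i)) [0..<n]) * s \<in> I" for n s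
    using that
  proof (induction n arbitrary: s)
    case (Suc n)
    have "commutator x y * s \<in> (commutator_quotient ^^ n) I" for x y
    proof (rule Suc.IH)
      fix a b
      \<comment> \<open>Putting \<open>x\<close> and \<open>y\<close> at index \<open>n\<close>
        makes \<open>[x, y]\<close> the last of the n + 1 commutators and leaves the first n
        unchanged.\<close>
      have eq: "map (\<lambda>i. commutator ((a(n := x)) i) ((b(n := y)) i)) [0..<n] =
            map (\<lambda>i. commutator (a i) (b i)) [0..<n]"
        by simp
      show "prod_list (map (\<lambda>i. commutator (a i) (b i)) [0..<n]) * (commutator x y * s) \<in> I"
        using Suc.prems[of "a(n := x)" "b(n := y)"] by (simp add: mult.assoc eq del: fun_upd_apply) simp
    qed
    then show ?case
      by (simp add: commutator_quotient_def[of "(commutator_quotient ^^ n) I"])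
  qed simp
  then show ?thesis
    using assms(2) by blast
qed

section \<open>The free associative algebra\<close>

definition nc_monomial :: "nat list \<Rightarrow> 'f::field free_algebra" where
  "nc_monomial w = Poly_Mapping.single (NC_Word w) 1"

lemma single_NC_Word_append:
  "Poly_Mapping.single (NC_Word (v @ w)) (c * d :: 'f::field) =
     Poly_Mapping.single (NC_Word v) c * Poly_Mapping.single (NC_Word w) d"
  by (simp add: mult_single plus_nc_word_def)

lemma sum_single_same_key:
  "(\<Sum>a\<in>A. Poly_Mapping.single x (g a)) = Poly_Mapping.single x (sum g A)"
  by (induction A rule: infinite_finite_induct) (simp_all add: single_add)

lemma nc_monomial_append: "nc_monomial (v @ w) = nc_monomial v * nc_monomial w"
  using single_NC_Word_append[of v w 1 1] by (simp add: nc_monomial_def)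

text \<open>Moving the letter \<open>i\<close> to the front of \<open>w = w1 @ i # w2\<close> costs
  a commutator of \<open>i\<close> with \<open>w1\<close>, multiplied by \<open>w2\<close> and
  \<open>s\<close>. The product of \<open>w2\<close> and \<open>s\<close> stays in the commutator
  quotient because that is a left ideal.\<close>

lemma nc_monomial_perm_mem_left_ideal:
  assumes "left_ideal_set I" "s \<in> commutator_quotient I" "mset v = mset w"
  shows "(nc_monomial v - nc_monomial w) * s \<in> I"
  using assms(3)
proof (induction v arbitrary: w)
  case Nil
  then have "w = []" by simp
  then show ?case using left_ideal_setD(1)[OF assms(1)] by simp
next
  case (Cons i v)
  note I = left_ideal_setD[OF assms(1)]
    and C = left_ideal_setD[OF left_ideal_set_commutator_quotient[OF assms(1)]]
  have "i \<in> set w"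
    using Cons.prems by (metis list.set_intros(1) mset_eq_setD)
  then obtain w1 w2 where w: "w = w1 @ i # w2"
    by (meson split_list)
  have "mset v = mset (w1 @ w2)"
    using Cons.prems w by simp
  note IH = Cons.IH[OF this]
  let ?X = "nc_monomial :: nat list \<Rightarrow> 'a free_algebra"
  have cons: "?X (i # u) = ?X [i] * ?X u" for u
    using nc_monomial_append[of "[i]" u] by simp
  have X: "?X (i # v) = ?X [i] * ?X v" "?X w = ?X w1 * ?X [i] * ?X w2"
    by (rule cons) (simp only: w nc_monomial_append cons[of w2] mult.assoc)
  have "(?X (i # v) - ?X w) * s =
      ?X [i] * ((?X v - ?X (w1 @ w2)) * s) + commutator (?X [i]) (?X w1) * (?X w2 * s)"
    unfolding X nc_monomial_append by (simp add: commutator_def algebra_simps)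
  then show ?case
    using I(2,3) IH C(3) assms(2) commutator_quotientD by metis
qed

lemma scalar_mult_commute:
  "Poly_Mapping.single 0 c * f = f * (Poly_Mapping.single 0 c :: 'f::field free_algebra)"
  by (induction f rule: poly_mapping_single_induct)
    (simp_all add: mult_single algebra_simps)

lemma lookup_map_scale: "Poly_Mapping.lookup (Poly_Mapping.map ((*) c) f) x = c * Poly_Mapping.lookup f x"
  for c :: "'f::field"
  by (simp add: Poly_Mapping.map.rep_eq when_def)

lemma map_scale_add:
  "Poly_Mapping.map ((*) c) (f + g) = Poly_Mapping.map ((*) c) f + Poly_Mapping.map ((*) c) g"
  for c :: "'f::field"
  by (rule poly_mapping_eqI) (simp add: lookup_map_scale lookup_add distrib_left)

lemma map_scale_zero [simp]: "Poly_Mapping.map ((*) c) 0 = 0" for c :: "'f::field"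
  by (rule poly_mapping_eqI) (simp add: lookup_map_scale)

lemma map_scale_single:
  "Poly_Mapping.map ((*) c) (Poly_Mapping.single x d) = Poly_Mapping.single x (c * d)"
  for c :: "'f::field"
  by (rule poly_mapping_eqI) (simp add: lookup_map_scale lookup_single when_def)

lemma map_scale_eq_mult: "Poly_Mapping.map ((*) c) f = Poly_Mapping.single 0 c * f"
  for f :: "'f::field free_algebra"
  by (induction f rule: poly_mapping_single_induct)
    (simp_all add: map_scale_add map_scale_single mult_single distrib_left)

section \<open>Substitution endomorphisms and T-ideals\<close>

definition nc_subst :: "(nat \<Rightarrow> 'f::field free_algebra) \<Rightarrow> 'f free_algebra \<Rightarrow> 'f free_algebra" where
  "nc_subst a f = (\<Sum>w\<in>Poly_Mapping.keys f.
     Poly_Mapping.single 0 (Poly_Mapping.lookup f w) * prod_list (map a (letters w)))"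

lemma nc_subst_single:
  "nc_subst a (Poly_Mapping.single w c) = Poly_Mapping.single 0 c * prod_list (map a (letters w))"
  by (simp add: nc_subst_def)

lemma nc_subst_add: "nc_subst a (f + g) = nc_subst a f + nc_subst a g"
  unfolding nc_subst_def
  by (rule setsum_keys_plus_distrib) (simp_all add: single_add distrib_right)

lemma nc_subst_zero [simp]: "nc_subst a 0 = 0"
  by (simp add: nc_subst_def)

lemma nc_subst_mult: "nc_subst a (f * g) = nc_subst a f * nc_subst a g"
proof (induction f rule: poly_mapping_single_induct)
  case (2 v c)
  show ?case
  proof (induction g rule: poly_mapping_single_induct)
    case (2 w d)
    let ?p = "\<lambda>w. prod_list (map a (letters w))" and ?s = "Poly_Mapping.single (0 :: nc_word)"
    have "nc_subst a (Poly_Mapping.single v c * Poly_Mapping.single w d) = ?s c * ?s d * (?p v * ?p w)"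
      by (simp add: mult_single nc_subst_single) (simp add: plus_nc_word_def mult.assoc)
    also have "\<dots> = ?s c * (?s d * ?p v) * ?p w"
      by (simp add: mult.assoc)
    also have "\<dots> = ?s c * (?p v * ?s d) * ?p w"
      by (simp only: scalar_mult_commute)
    finally show ?case
      by (simp add: nc_subst_single mult.assoc)
  qed (simp_all add: nc_subst_add distrib_left)
qed (simp_all add: nc_subst_add distrib_right)

lemma algebra_endomorphism_nc_subst: "algebra_endomorphism (nc_subst a)"
proof -
  have "nc_subst a (Poly_Mapping.single 0 c) = Poly_Mapping.single 0 c" for c
    by (simp add: nc_subst_single zero_nc_word_def)
  then show ?thesis
    unfolding algebra_endomorphism_def
    using single_one by (metis nc_subst_add nc_subst_mult map_scale_eq_mult)
qed

lemma nc_subst_var: "nc_subst a (nc_var i) = a i"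
  by (simp add: nc_var_def nc_subst_single single_one)

lemma algebra_endomorphism_diff:
  assumes "algebra_endomorphism \<phi>"
  shows "\<phi> (f - g) = \<phi> f - \<phi> g"
  using assms unfolding algebra_endomorphism_def by (metis add_diff_cancel diff_add_cancel)

lemma algebra_endomorphism_commutator_product:
  assumes "algebra_endomorphism \<phi>"
  shows "\<phi> (commutator_product m) =
    prod_list (map (\<lambda>i. commutator (\<phi> (nc_var (2 * i))) (\<phi> (nc_var (2 * i + 1)))) [0..<m])"
proof -
  have [simp]: "\<phi> (f * g) = \<phi> f * \<phi> g" "\<phi> 1 = 1" for f g
    using assms by (auto simp: algebra_endomorphism_def)
  have "\<phi> (prod_list xs) = prod_list (map \<phi> xs)" for xs
    by (induction xs) auto
  then show ?thesis
    by (simp add: commutator_product_def comp_def commutator_def algebra_endomorphism_diff[OF assms])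
qed

lemma T_ideal_commutator_prods:
  assumes "T_ideal I" "commutator_product m \<in> I"
  shows "prod_list (map (\<lambda>i. commutator (a i) (b i)) [0..<m]) \<in> I"
proof -
  \<comment> \<open>Factor \<open>i\<close> of \<open>commutator_product\<close> has the letters
    \<open>2 * i\<close> and \<open>2 * i + 1\<close>, so parity selects between \<open>a\<close>
    and \<open>b\<close>, and halving recovers \<open>i\<close>.\<close>
  define \<phi> where "\<phi> = nc_subst (\<lambda>j. if even j then a (j div 2) else b (j div 2))"
  have endo: "algebra_endomorphism \<phi>"
    by (simp add: \<phi>_def algebra_endomorphism_nc_subst)
  have "\<phi> (commutator_product m) \<in> I"
    using assms(2) endo assms(1)[unfolded T_ideal_def] by (simp add: image_subset_iff)
  then show ?thesis
    by (simp add: algebra_endomorphism_commutator_product[OF endo]) (simp add: \<phi>_def nc_subst_var)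
qed

text \<open>The linear extension of \<open>g\<close> from words to the free algebra.\<close>

definition word_sum :: "(nat list \<Rightarrow> 'f) \<Rightarrow> 'f::field free_algebra \<Rightarrow> 'f" where
  "word_sum g f = (\<Sum>w\<in>Poly_Mapping.keys f. Poly_Mapping.lookup f w * g (letters w))"

lemma word_sum_simps [simp]:
  "word_sum g 0 = 0"
  "word_sum g (Poly_Mapping.single w c) = c * g (letters w)"
  "word_sum g (f + f') = word_sum g f + word_sum g f'"
proof -
  show "word_sum g (f + f') = word_sum g f + word_sum g f'"
    unfolding word_sum_def by (rule setsum_keys_plus_distrib) (simp_all add: distrib_right)
qed (simp_all add: word_sum_def)

lemma word_sum_sum: "word_sum g (sum f A) = (\<Sum>x\<in>A. word_sum g (f x))"
  by (induction A rule: infinite_finite_induct) auto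

section \<open>Fox derivatives over the commutative polynomial ring\<close>

definition fox_index :: "'f::field free_algebra \<Rightarrow> (nc_word \<times> nat) set" where
  "fox_index f = (SIGMA w:Poly_Mapping.keys f. {..<length (letters w)})"

definition fox_type :: "nc_word \<times> nat \<Rightarrow> nat multiset \<times> nat" where
  "fox_type = (\<lambda>(w, k). (mset (take k (letters w)), letters w ! k))"

text \<open>Collects the tails behind all occurrences of type \<open>y\<close>. This is the
  component of a Fox derivative at one commutative monomial: prefixes are made commutative, tails
  remain words.\<close>

definition fox_derivative :: "nat multiset \<times> nat \<Rightarrow> 'f::field free_algebra \<Rightarrow> 'f free_algebra" where
  "fox_derivative y f = (\<Sum>(w, k)\<in>{x \<in> fox_index f. fox_type x = y}.
     Poly_Mapping.single (NC_Word (drop (Suc k) (letters w))) (Poly_Mapping.lookup f w))"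

lemma finite_fox_index [simp]: "finite (fox_index f)"
  by (simp add: fox_index_def)

abbreviation sorted_word :: "nat multiset \<Rightarrow> nc_word" where
  "sorted_word M \<equiv> NC_Word (sorted_list_of_multiset M)"

definition sorting_defect :: "nat multiset \<times> nat \<Rightarrow> 'f::field free_algebra" where
  "sorting_defect = (\<lambda>(M, i). nc_monomial (sorted_list_of_multiset M @ [i]) -
     nc_monomial (sorted_list_of_multiset (M + {#i#})))"

text \<open>Summand \<open>k\<close> is the difference between \<open>u\<close> with its first
  \<open>k\<close> letters sorted and \<open>u\<close> with its first \<open>k + 1\<close> letters
  sorted, scaled by \<open>c\<close>; so the sum telescopes.\<close>

lemma sorting_defect_telescope:
  "(\<Sum>k<length u. sorting_defect (mset (take k u), u ! k) *
      Poly_Mapping.single (NC_Word (drop (Suc k) u)) c) =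
    Poly_Mapping.single (NC_Word u) c - Poly_Mapping.single (sorted_word (mset u)) (c :: 'f::field)"
proof -
  define h where "h k = Poly_Mapping.single (NC_Word (sorted_list_of_multiset (mset (take k u)) @ drop k u)) c" for k
  have "sorting_defect (mset (take k u), u ! k) * Poly_Mapping.single (NC_Word (drop (Suc k) u)) c =
      h k - h (Suc k)" if "k < length u" for k
  proof -
    have 1: "mset (take k u) + {#u ! k#} = mset (take (Suc k) u)"
      using that by (simp add: take_Suc_conv_app_nth)
    have 2: "drop k u = [u ! k] @ drop (Suc k) u"
      using that by (simp add: Cons_nth_drop_Suc)
    have "nc_monomial v * Poly_Mapping.single (NC_Word w) c = Poly_Mapping.single (NC_Word (v @ w)) c" for v w
      using single_NC_Word_append[of v w 1 c] by (simp add: nc_monomial_def)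
    then show ?thesis
      unfolding sorting_defect_def prod.case left_diff_distrib 1 h_def
      by (subst 2) simp
  qed
  then have "(\<Sum>k<length u. sorting_defect (mset (take k u), u ! k) *
      Poly_Mapping.single (NC_Word (drop (Suc k) u)) c) = (\<Sum>k<length u. h k - h (Suc k))"
    by simp
  also have "\<dots> = h 0 - h (length u)"
    by (rule sum_lessThan_telescope')
  finally show ?thesis
    by (simp add: h_def)
qed

text \<open>Apply the telescoping to each word of \<open>f\<close>. The defect depends only on the
  type of an occurrence, so tails of a common type combine into one Fox derivative.\<close>

lemma fox_decomposition:
  "f = (\<Sum>w\<in>Poly_Mapping.keys f. Poly_Mapping.single (sorted_word (mset (letters w))) (Poly_Mapping.lookup f w)) +
     (\<Sum>y\<in>fox_type ` fox_index f. sorting_defect y * fox_derivative y f)"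
proof -
  let ?t = "\<lambda>(w, k). Poly_Mapping.single (NC_Word (drop (Suc k) (letters w))) (Poly_Mapping.lookup f w)"
  have "(\<Sum>y\<in>fox_type ` fox_index f. sorting_defect y * fox_derivative y f) =
      (\<Sum>y\<in>fox_type ` fox_index f. \<Sum>x\<in>{x \<in> fox_index f. fox_type x = y}. sorting_defect (fox_type x) * ?t x)"
    by (simp add: fox_derivative_def sum_distrib_left)
  also have "\<dots> = (\<Sum>x\<in>fox_index f. sorting_defect (fox_type x) * ?t x)"
    by (rule sum.image_gen[symmetric]) simp
  also have "\<dots> = (\<Sum>w\<in>Poly_Mapping.keys f. \<Sum>k<length (letters w).
      sorting_defect (mset (take k (letters w)), letters w ! k) *
      Poly_Mapping.single (NC_Word (drop (Suc k) (letters w))) (Poly_Mapping.lookup f w))"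
    unfolding fox_index_def by (subst sum.Sigma) (auto simp: fox_type_def intro!: sum.cong)
  also have "\<dots> = f - (\<Sum>w\<in>Poly_Mapping.keys f.
      Poly_Mapping.single (sorted_word (mset (letters w))) (Poly_Mapping.lookup f w))"
    by (simp add: sorting_defect_telescope sum_subtractf poly_mapping_sum_singles)
  finally show ?thesis
    by simp
qed

text \<open>The condition \<open>abelian\<close> says that \<open>f\<close> vanishes in the
  commutative polynomial ring, which kills the sorted part. The two words in a sorting defect have
  the same letters, so the other terms lie in \<open>I\<close> by \<open>fox\<close>.\<close>

lemma mem_left_ideal_if_fox_derivatives:
  assumes "left_ideal_set I"
    and abelian: "\<And>M. (\<Sum>w\<in>{w \<in> Poly_Mapping.keys f. mset (letters w) = M}. Poly_Mapping.lookup f w) = 0"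
    and fox: "\<And>y. fox_derivative y f \<in> commutator_quotient I"
  shows "f \<in> I"
proof -
  have "(\<Sum>w\<in>Poly_Mapping.keys f. Poly_Mapping.single (sorted_word (mset (letters w))) (Poly_Mapping.lookup f w)) =
    (\<Sum>M\<in>(\<lambda>w. mset (letters w)) ` Poly_Mapping.keys f.
       \<Sum>w\<in>{w \<in> Poly_Mapping.keys f. mset (letters w) = M}. Poly_Mapping.single (sorted_word M) (Poly_Mapping.lookup f w))"
    by (subst sum.image_gen[where g = "\<lambda>w. mset (letters w)"]) (auto intro!: sum.cong)
  also have "\<dots> = 0"
    by (simp add: sum_single_same_key abelian)
  finally have eq: "(\<Sum>y\<in>fox_type ` fox_index f. sorting_defect y * fox_derivative y f) = f"
    using fox_decomposition[of f] by simp
  have "sorting_defect y * fox_derivative y f \<in> I" for y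
    using nc_monomial_perm_mem_left_ideal[OF assms(1) fox]
    by (auto simp: sorting_defect_def split: prod.splits)
  then have "(\<Sum>y\<in>fox_type ` fox_index f. sorting_defect y * fox_derivative y f) \<in> I"
    by (rule left_ideal_set_sum[OF assms(1)])
  then show ?thesis
    by (simp only: eq)
qed

section \<open>Linear independence of commutative monomials\<close>

text \<open>Dedekind's argument: rescaling one variable by 2 separates two distinct monomials.\<close>

lemma monomial_functions_independent:
  fixes c :: "'a multiset \<Rightarrow> 'f::field_char_0"
  assumes "finite S" "\<And>t. (\<Sum>M\<in>S. c M * (\<Prod>x\<in>#M. t x)) = 0" "M \<in> S"
  shows "c M = 0"
  using assms
proof (induction S arbitrary: c M)
  case (insert N S)
  have "c K = 0" if "K \<in> S" for K
  proof -
    have "K \<noteq> N"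
      using that insert.hyps by auto
    then obtain i where i: "count K i \<noteq> count N i"
      by (meson multiset_eqI)
    \<comment> \<open>The relation at the rescaled \<open>t'\<close> minus
      \<open>2 ^ count N i\<close> times the relation at \<open>t\<close> no longer involves
      \<open>N\<close>, so the induction hypothesis applies.\<close>
    have "(2 ^ count K i - 2 ^ count N i) * c K = 0"
    proof (rule insert.IH[OF _ that])
      fix t :: "'a \<Rightarrow> 'f"
      define t' where "t' x = (if x = i then 2 else 1) * t x" for x
      have t': "(\<Prod>x\<in>#M. t' x) = 2 ^ count M i * (\<Prod>x\<in>#M. t x)" for M
        by (induction M) (auto simp: t'_def)
      have "(\<Sum>M\<in>S. (2 ^ count M i - 2 ^ count N i) * c M * (\<Prod>x\<in>#M. t x)) =
        (\<Sum>M\<in>insert N S. (2 ^ count M i - 2 ^ count N i) * c M * (\<Prod>x\<in>#M. t x))"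
        using insert.hyps by simp
      also have "\<dots> = (\<Sum>M\<in>insert N S. c M * (\<Prod>x\<in>#M. t' x)) -
          2 ^ count N i * (\<Sum>M\<in>insert N S. c M * (\<Prod>x\<in>#M. t x))"
        by (simp only: t' sum_distrib_left sum_subtractf[symmetric]) (simp add: algebra_simps)
      also have "\<dots> = 0"
        by (simp only: insert.prems(1)) simp
      finally show "(\<Sum>M\<in>S. (2 ^ count M i - 2 ^ count N i) * c M * (\<Prod>x\<in>#M. t x)) = 0" .
    qed
    \<comment> \<open>Characteristic zero keeps distinct powers of 2 distinct in the field, so the
      factor cancels.\<close>
    moreover have "(2 :: 'f) ^ count K i \<noteq> 2 ^ count N i"
    proof -
      have "(2 :: nat) ^ count K i \<noteq> 2 ^ count N i"
        using i by simp
      then have "of_nat (2 ^ count K i) \<noteq> (of_nat (2 ^ count N i) :: 'f)"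
        using of_nat_eq_iff by blast
      then show ?thesis by simp
    qed
    ultimately show ?thesis by simp
  qed
  \<comment> \<open>With all variables set to 1, only the coefficient of \<open>N\<close> is
    left.\<close>
  moreover from this have "c N = 0"
    using insert.prems(1)[of "\<lambda>_. 1"] insert.hyps by simp
  ultimately show ?case
    using insert.prems(2) by auto
qed simp

text \<open>Several indices may share a monomial, as words with the same letters do; independence
  then determines only the sum of their coefficients.\<close>

lemma monomial_functions_independent_family:
  fixes c :: "'b \<Rightarrow> 'f::field_char_0" and \<mu> :: "'b \<Rightarrow> 'a multiset"
  assumes "finite K" "\<And>t. (\<Sum>x\<in>K. c x * (\<Prod>y\<in>#\<mu> x. t y)) = 0"
  shows "(\<Sum>x\<in>{x \<in> K. \<mu> x = M}. c x) = 0"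
proof (cases "M \<in> \<mu> ` K")
  case True
  have "(\<Sum>N\<in>\<mu> ` K. (\<Sum>x\<in>{x \<in> K. \<mu> x = N}. c x) * (\<Prod>y\<in>#N. t y)) = 0" for t
    using assms(2)[of t] sum.image_gen[OF assms(1), of "\<lambda>x. c x * (\<Prod>y\<in>#\<mu> x. t y)" \<mu>]
    by (simp add: sum_distrib_right)
  then show ?thesis
    using monomial_functions_independent[OF finite_imageI[OF assms(1)] _ True,
        where c = "\<lambda>N. \<Sum>x\<in>{x \<in> K. \<mu> x = N}. c x"] by simp
next
  case False
  then have "{x \<in> K. \<mu> x = M} = {}" by auto
  then show ?thesis by (simp only: sum.empty)
qed

section \<open>Weights of words along a walk\<close>

text \<open>
  \<open>walk_weight h T U v p w\<close> is the coefficient of the path with arrows \<open>p\<close> starting at \<open>v\<close> in the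
  product \<open>a w\<^sub>1 \<cdots> a w\<^sub>n\<close>, where \<open>a i\<close> has coefficient \<open>T v i\<close> at the lazy path at \<open>v\<close>, \<open>U e i\<close> at the
  arrow \<open>e\<close>, and 0 elsewhere; \<open>h\<close> maps an arrow to its terminal vertex.
\<close>

fun walk_weight ::
  "('e \<Rightarrow> 'v) \<Rightarrow> ('v \<Rightarrow> nat \<Rightarrow> 'f) \<Rightarrow> ('e \<Rightarrow> nat \<Rightarrow> 'f) \<Rightarrow> 'v \<Rightarrow> 'e list \<Rightarrow> nat list \<Rightarrow> 'f::field" where
  "walk_weight h T U v [] [] = 1"
| "walk_weight h T U v (e # p) [] = 0"
| "walk_weight h T U v [] (i # w) = T v i * walk_weight h T U v [] w"
| "walk_weight h T U v (e # p) (i # w) =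
     T v i * walk_weight h T U v (e # p) w + U e i * walk_weight h T U (h e) p w"

lemma walk_weight_Nil: "walk_weight h T U v [] w = (\<Prod>i\<in>#mset w. T v i)"
  by (induction w) auto

text \<open>Split by the position \<open>k\<close> at which the arrow \<open>e\<close> is taken: the
  letters before it act through the lazy path at \<open>v\<close> and give a commutative monomial,
  those behind it continue along \<open>p\<close>. This is the shape of a Fox derivative.\<close>

lemma walk_weight_Cons:
  "walk_weight h T U v (e # p) w = (\<Sum>k<length w. (\<Prod>i\<in>#mset (take k w). T v i) *
     (U e (w ! k) * walk_weight h T U (h e) p (drop (Suc k) w)))"
  by (induction w) (simp_all add: sum.lessThan_Suc_shift sum_distrib_left mult.assoc add.commute del: sum.lessThan_Suc)

lemma walk_weight_cong:
  assumes "\<And>x. x \<in> set (v # map h p) \<Longrightarrow> T x = T' x" "\<And>e. e \<in> set p \<Longrightarrow> U e = U' e"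
  shows "walk_weight h T U v p w = walk_weight h T' U' v p w"
  using assms by (induction h T U v p w rule: walk_weight.induct) auto

text \<open>Fox derivatives lead to the path without its first arrow and to the commutator quotient.
  All initial segments occur in the hypothesis: the lazy one makes \<open>f\<close> vanish in the
  commutative ring, those beginning with the first arrow control the Fox derivatives.\<close>

lemma mem_left_ideal_if_walk_weights:
  fixes f :: "'f::field_char_0 free_algebra" and h :: "'e \<Rightarrow> 'v"
  assumes "left_ideal_set I" "(commutator_quotient ^^ Suc (length p)) I = UNIV"
    and "distinct (v # map h p)"
    and "\<And>T U k. word_sum (walk_weight h T U v (take k p)) f = 0"
  shows "f \<in> I"
  using assms
proof (induction p arbitrary: v f I)
  have abelian: "(\<Sum>w\<in>{w \<in> Poly_Mapping.keys f. mset (letters w) = M}. Poly_Mapping.lookup f w) = 0"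
    if "\<And>T U k. word_sum (walk_weight h T U v (take k p)) f = 0" for p v M and f :: "'f free_algebra"
  proof (rule monomial_functions_independent_family)
    fix t
    show "(\<Sum>w\<in>Poly_Mapping.keys f. Poly_Mapping.lookup f w * (\<Prod>i\<in>#mset (letters w). t i)) = 0"
      \<comment> \<open>The segment \<open>take 0 p\<close> is lazy, and its weight is the monomial
        in the values \<open>t\<close>.\<close>
      using that[of "\<lambda>_. t" "\<lambda>_ _. 0" 0] by (simp add: word_sum_def walk_weight_Nil)
  qed simp
  {
    case Nil
    \<comment> \<open>A single commutator quotient is already everything here, so the condition on
      Fox derivatives is void.\<close>
    then show ?case
      using mem_left_ideal_if_fox_derivatives[OF Nil(1) abelian[OF Nil(4)]] by auto
  next
    case (Cons e p)
    have dist: "distinct (h e # map h p)" "v \<notin> set (h e # map h p)" "e \<notin> set p"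
      using Cons.prems(3) by auto
    have "fox_derivative (M, j) f \<in> commutator_quotient I" for M j
    proof (rule Cons.IH)
      show "left_ideal_set (commutator_quotient I)"
        by (intro left_ideal_set_commutator_quotient Cons.prems)
      show "(commutator_quotient ^^ Suc (length p)) (commutator_quotient I) = UNIV"
        using Cons.prems(2) by (simp only: funpow_swap1[symmetric] funpow.simps o_apply list.size add_Suc_right add_0_right)
      show "distinct (h e # map h p)" by fact
      fix T :: "'v \<Rightarrow> nat \<Rightarrow> 'f" and U :: "'e \<Rightarrow> nat \<Rightarrow> 'f" and k
      define g where "g = walk_weight h T U (h e) (take k p)"
      \<comment> \<open>The contribution of one occurrence without the monomial of its prefix:
        letters other than \<open>j\<close> give 0, and the tail is weighed by
        \<open>g\<close>.\<close>
      define c where "c = (\<lambda>(w, k). Poly_Mapping.lookup f w *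
        ((if letters w ! k = j then 1 else 0) * g (drop (Suc k) (letters w))))"
      have "(\<Sum>x\<in>fox_index f. c x * (\<Prod>i\<in>#fst (fox_type x). t i)) = 0" for t
      proof -
        \<comment> \<open>Free values at \<open>v\<close> make the prefix monomials independent, and
          the indicator at \<open>e\<close> singles out the letter \<open>j\<close>. As the vertices
          are distinct, neither \<open>v\<close> nor \<open>e\<close> recurs, and the tails keep
          their weights.\<close>
        define T' where "T' = T(v := t)"
        define U' where "U' = U(e := (\<lambda>i. if i = j then 1 else 0))"
        have g: "walk_weight h T' U' (h e) (take k p) w = g w" for w
          unfolding g_def T'_def U'_def
          by (rule walk_weight_cong) (use dist in \<open>auto dest!: in_set_takeD\<close>)
        have "(\<Sum>x\<in>fox_index f. c x * (\<Prod>i\<in>#fst (fox_type x). t i)) =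
          (\<Sum>w\<in>Poly_Mapping.keys f. \<Sum>k<length (letters w). c (w, k) * (\<Prod>i\<in>#fst (fox_type (w, k)). t i))"
          unfolding fox_index_def by (subst sum.Sigma) (auto intro!: sum.cong)
        also have "\<dots> = word_sum (walk_weight h T' U' v (take (Suc k) (e # p))) f"
          by (simp add: word_sum_def walk_weight_Cons g sum_distrib_left)
            (auto simp: c_def fox_type_def T'_def U'_def intro!: sum.cong)
        finally show ?thesis
          by (simp only: Cons.prems(4))
      qed
      then have *: "(\<Sum>x\<in>{x \<in> fox_index f. fst (fox_type x) = M}. c x) = 0"
        by (intro monomial_functions_independent_family) simp_all
      have "word_sum g (fox_derivative (M, j) f) =
         (\<Sum>x\<in>{x \<in> fox_index f. fox_type x = (M, j)}. c x)"
        unfolding fox_derivative_def word_sum_sum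
        by (rule sum.cong) (auto simp: c_def fox_type_def)
      \<comment> \<open>The larger index set adds occurrences of other letters, where
        \<open>c\<close> is 0.\<close>
      also have "\<dots> = (\<Sum>x\<in>{x \<in> fox_index f. fst (fox_type x) = M}. c x)"
      proof (rule sum.mono_neutral_left)
        have "c x = 0" if "snd (fox_type x) \<noteq> j" for x
          using that by (simp add: c_def fox_type_def split: prod.splits)
        then show "\<forall>x\<in>{x \<in> fox_index f. fst (fox_type x) = M} - {x \<in> fox_index f. fox_type x = (M, j)}. c x = 0"
          by (auto simp: prod_eq_iff)
      qed auto
      finally show "word_sum (walk_weight h T U (h e) (take k p)) (fox_derivative (M, j) f) = 0"
        using * by (simp add: g_def)
    qed
    then show ?case
      using mem_left_ideal_if_fox_derivatives[OF Cons.prems(1) abelian[OF Cons.prems(4)]] by (metis surj_pair)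
  }
qed

section \<open>Evaluation in the path algebra\<close>

lemma map_scale_scalar_add:
  "Poly_Mapping.map ((*) (c + d)) f = Poly_Mapping.map ((*) c) f + Poly_Mapping.map ((*) d) f"
  for c :: "'f::field"
  by (rule poly_mapping_eqI) (simp add: lookup_map_scale lookup_add distrib_right)

lemma map_scale_by_zero [simp]: "Poly_Mapping.map ((*) 0) f = (0 :: 'a \<Rightarrow>\<^sub>0 'f::field)"
  by (rule poly_mapping_eqI) (simp add: lookup_map_scale)

lemma map_scale_by_one [simp]: "Poly_Mapping.map ((*) 1) f = f" for f :: "'a \<Rightarrow>\<^sub>0 'f::field"
  by (rule poly_mapping_eqI) (simp add: lookup_map_scale)

lemma map_scale_map_scale:
  "Poly_Mapping.map ((*) c) (Poly_Mapping.map ((*) d) f) = Poly_Mapping.map ((*) (c * d)) f"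
  for c :: "'f::field"
  by (rule poly_mapping_eqI) (simp add: lookup_map_scale mult.assoc)

lemma keys_map_scale: "Poly_Mapping.keys (Poly_Mapping.map ((*) c) f) \<subseteq> Poly_Mapping.keys f"
  for c :: "'f::field"
  by (auto simp: in_keys_iff lookup_map_scale)

lemma path_mult_map_scale_left:
  "path_mult (Poly_Mapping.map ((*) c) f) g = Poly_Mapping.map ((*) c) (path_mult f g)"
proof (induction f rule: poly_mapping_single_induct)
  case (2 p a)
  show ?case
    by (induction g rule: poly_mapping_single_induct)
      (simp_all add: map_scale_single path_mult_single map_scale_add path_mult_add_right mult.assoc)
qed (simp_all add: map_scale_add path_mult_add_left)

lemma path_mult_map_scale_right:
  "path_mult f (Poly_Mapping.map ((*) c) g) = Poly_Mapping.map ((*) c) (path_mult f g)"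
proof (induction f rule: poly_mapping_single_induct)
  case (2 p a)
  show ?case
    by (induction g rule: poly_mapping_single_induct)
      (simp_all add: map_scale_single path_mult_single map_scale_add path_mult_add_right mult.left_commute)
qed (simp_all add: map_scale_add path_mult_add_left)

abbreviation path_one :: "('v, 'e) pre_digraph \<Rightarrow> (('v, 'e) quiver_path \<Rightarrow>\<^sub>0 'f::field)" where
  "path_one Q \<equiv> (\<Sum>v\<in>verts Q. Poly_Mapping.single (v, [], v) 1)"

definition path_word :: "('v, 'e) pre_digraph \<Rightarrow> (nat \<Rightarrow> ('v, 'e) quiver_path \<Rightarrow>\<^sub>0 'f::field) \<Rightarrow>
    nat list \<Rightarrow> (('v, 'e) quiver_path \<Rightarrow>\<^sub>0 'f)" where
  "path_word Q a w = foldr (\<lambda>i. path_mult (a i)) w (path_one Q)"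

text \<open>Ordinary sums over the whole type free linearity from carrier conditions;
  \<open>eval_poly_path_algebra\<close> is the link to \<open>eval_poly\<close>.\<close>

definition path_eval :: "('v, 'e) pre_digraph \<Rightarrow> (nat \<Rightarrow> ('v, 'e) quiver_path \<Rightarrow>\<^sub>0 'f::field) \<Rightarrow>
    'f free_algebra \<Rightarrow> (('v, 'e) quiver_path \<Rightarrow>\<^sub>0 'f)" where
  "path_eval Q a f = (\<Sum>w\<in>Poly_Mapping.keys f.
     Poly_Mapping.map ((*) (Poly_Mapping.lookup f w)) (path_word Q a (letters w)))"

lemma path_word_simps [simp]:
  "path_word Q a [] = path_one Q"
  "path_word Q a (i # w) = path_mult (a i) (path_word Q a w)"
  by (simp_all add: path_word_def)

lemma path_eval_simps [simp]:
  "path_eval Q a 0 = 0"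
  "path_eval Q a (Poly_Mapping.single w c) = Poly_Mapping.map ((*) c) (path_word Q a (letters w))"
  "path_eval Q a (f + g) = path_eval Q a f + path_eval Q a g"
proof -
  show "path_eval Q a (f + g) = path_eval Q a f + path_eval Q a g"
    unfolding path_eval_def by (rule setsum_keys_plus_distrib) (rule map_scale_by_zero map_scale_scalar_add)+
qed (simp_all add: path_eval_def)

lemma path_eval_diff: "path_eval Q a (f - g) = path_eval Q a f - path_eval Q a g"
  using path_eval_simps(3)[of Q a "f - g" g] by (simp add: eq_diff_eq)

lemma path_eval_one: "path_eval Q a 1 = path_one Q"
  using path_eval_simps(2)[of Q a 0 1, unfolded map_scale_by_one single_one] by (simp add: zero_nc_word_def)

lemma path_eval_map_scale:
  "path_eval Q a (Poly_Mapping.map ((*) c) f) = Poly_Mapping.map ((*) c) (path_eval Q a f)"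
  by (induction f rule: poly_mapping_single_induct)
    (simp_all add: map_scale_single map_scale_map_scale map_scale_add)

definition assignment :: "('v, 'e) pre_digraph \<Rightarrow> (nat \<Rightarrow> ('v, 'e) quiver_path \<Rightarrow>\<^sub>0 'f::field) \<Rightarrow> bool" where
  "assignment Q a \<longleftrightarrow> (\<forall>i. Poly_Mapping.keys (a i) \<subseteq> quiver_paths Q)"

context
  fixes Q :: "('v, 'e) pre_digraph"
  assumes fin: "fin_digraph Q"
begin

interpretation Q: fin_digraph Q by (rule fin)

lemma keys_path_word:
  assumes "assignment Q a"
  shows "Poly_Mapping.keys (path_word Q a w) \<subseteq> quiver_paths Q"
proof (induction w)
  case Nil
  have "Poly_Mapping.keys (path_one Q :: ('v, 'e) quiver_path \<Rightarrow>\<^sub>0 'a) \<subseteq> quiver_paths Q"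
    by (rule order.trans[OF keys_sum]) (auto simp: quiver_paths_def Q.awalk_Nil_iff)
  then show ?case by simp
next
  case (Cons i w)
  then show ?case
    using assms path_mult_carrier[OF _ Cons Q.wf_digraph] by (simp add: assignment_def)
qed

lemma keys_path_eval:
  assumes "assignment Q a"
  shows "Poly_Mapping.keys (path_eval Q a f) \<subseteq> quiver_paths Q"
  unfolding path_eval_def
  by (intro order.trans[OF keys_sum] UN_least order.trans[OF keys_map_scale] keys_path_word assms)

lemma path_word_append:
  assumes "assignment Q a"
  shows "path_word Q a (v @ w) = path_mult (path_word Q a v) (path_word Q a w)"
  by (induction v)
    (simp_all add: path_mult_assoc one_path_mult(1)[OF keys_path_word[OF assms]] Q.wf_digraph)

lemma path_eval_mult:
  assumes "assignment Q a"
  shows "path_eval Q a (f * g) = path_mult (path_eval Q a f) (path_eval Q a g)"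
proof (induction f rule: poly_mapping_single_induct)
  case (2 v c)
  show ?case
  proof (induction g rule: poly_mapping_single_induct)
    case (2 w d)
    have "letters (v + w) = letters v @ letters w"
      by (simp add: plus_nc_word_def)
    then show ?case
      by (simp add: mult_single path_word_append[OF assms] path_mult_map_scale_left
          path_mult_map_scale_right map_scale_map_scale mult.commute)
  qed (simp_all add: distrib_left path_mult_add_right)
qed (simp_all add: distrib_right path_mult_add_left)

section \<open>The identities of a path algebra form a T-ideal\<close>

lemma eval_poly_path_algebra:
  fixes a :: "nat \<Rightarrow> ('v, 'e) quiver_path \<Rightarrow>\<^sub>0 'f::field"
  assumes "assignment Q a"
  shows "eval_poly (path_algebra Q) a f = path_eval Q a f"
proof -
  define A where "A = (path_algebra Q :: ('f, ('v, 'e) quiver_path \<Rightarrow>\<^sub>0 'f) module)"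
  interpret A: ring A
    unfolding A_def by (rule ring_path_algebra[OF fin])
  have car: "carrier A = {f. Poly_Mapping.keys f \<subseteq> quiver_paths Q}" "add A = (+)" "zero A = 0"
    by (simp_all add: A_def path_algebra_def)
  have finsum: "finsum A g S = sum g S" if "finite S" "g \<in> S \<rightarrow> carrier A" for g and S :: "nc_word set"
    using that by (induction S rule: finite_induct) (simp_all add: A.finsum_insert car(2,3))
  have word: "eval_word A a w = path_word Q a (letters w)" for w
    by (simp add: eval_word_def path_word_def A_def path_algebra_def)
  have smult: "smult A c x = Poly_Mapping.map ((*) c) x" for c x
    by (simp add: A_def path_algebra_def)
  have "eval_poly A a f = path_eval Q a f"
    unfolding eval_poly_def path_eval_def word smult
    by (rule finsum) (use keys_path_word[OF assms] keys_map_scale in \<open>fastforce simp: car(1)\<close>)+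
  then show ?thesis
    by (simp add: A_def)
qed

lemma poly_identities_path_algebra:
  "poly_identities (path_algebra Q :: ('f::field, ('v, 'e) quiver_path \<Rightarrow>\<^sub>0 'f) module) =
     {f. \<forall>a. assignment Q a \<longrightarrow> path_eval Q a f = 0}"
proof -
  have "(\<forall>i. a i \<in> carrier (path_algebra Q)) \<longleftrightarrow> assignment Q a"
    for a :: "nat \<Rightarrow> ('v, 'e) quiver_path \<Rightarrow>\<^sub>0 'f"
    by (simp add: path_algebra_def assignment_def)
  moreover have "zero (path_algebra Q :: ('f, ('v, 'e) quiver_path \<Rightarrow>\<^sub>0 'f) module) = 0"
    by (simp add: path_algebra_def)
  ultimately show ?thesis
    unfolding poly_identities_def by (simp add: eval_poly_path_algebra cong: imp_cong)
qed

text \<open>An endomorphism followed by an evaluation is again an evaluation: compare monomials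
  letter by letter and extend linearly. This makes the identities stable under
  endomorphisms.\<close>

lemma path_eval_endomorphism:
  assumes "assignment Q a" "algebra_endomorphism \<phi>"
  shows "path_eval Q a (\<phi> f) = path_eval Q (\<lambda>i. path_eval Q a (\<phi> (nc_var i))) f"
proof -
  have \<phi>: "\<phi> (f + g) = \<phi> f + \<phi> g" "\<phi> (f * g) = \<phi> f * \<phi> g" "\<phi> 1 = 1"
    "\<phi> (Poly_Mapping.map ((*) c) f) = Poly_Mapping.map ((*) c) (\<phi> f)" for f g c
    using assms(2) unfolding algebra_endomorphism_def by blast+
  have mon: "path_eval Q a (\<phi> (nc_monomial w)) = path_word Q (\<lambda>i. path_eval Q a (\<phi> (nc_var i))) w" for w
  proof (induction w)
    case Nil
    have "nc_monomial [] = (1 :: 'a free_algebra)"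
      by (simp add: nc_monomial_def flip: zero_nc_word_def)
    then show ?case by (simp add: \<phi> path_eval_one)
  next
    case (Cons i w)
    have "nc_monomial (i # w) = nc_var i * (nc_monomial w :: 'a free_algebra)"
      using nc_monomial_append[of "[i]" w] by (simp add: nc_monomial_def nc_var_def)
    then show ?case
      using Cons by (simp add: \<phi> path_eval_mult[OF assms(1)])
  qed
  show ?thesis
  proof (induction f rule: poly_mapping_single_induct)
    case 1
    have "\<phi> 0 = 0" using \<phi>(1)[of 0 0] by simp
    then show ?case by simp
  next
    case (2 w c)
    have "Poly_Mapping.single w c = Poly_Mapping.map ((*) c) (nc_monomial (letters w))"
      by (simp add: nc_monomial_def map_scale_single)
    then have "path_eval Q a (\<phi> (Poly_Mapping.single w c)) =
        Poly_Mapping.map ((*) c) (path_eval Q a (\<phi> (nc_monomial (letters w))))"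
      by (simp only: \<phi>(4) path_eval_map_scale)
    then show ?case
      by (simp add: mon)
  qed (simp add: \<phi>)
qed

lemma T_ideal_poly_identities:
  "T_ideal (poly_identities (path_algebra Q :: ('f::field, ('v, 'e) quiver_path \<Rightarrow>\<^sub>0 'f) module))"
proof -
  have "\<phi> f \<in> {f. \<forall>a. assignment Q a \<longrightarrow> path_eval Q a f = 0}"
    if "f \<in> {f. \<forall>a. assignment Q a \<longrightarrow> path_eval Q a f = 0}" "algebra_endomorphism \<phi>"
    for f :: "'f free_algebra" and \<phi>
  proof -
    have "assignment Q (\<lambda>i. path_eval Q a (\<phi> (nc_var i)))" if "assignment Q a" for a
      using keys_path_eval[OF that] by (simp add: assignment_def)
    then have "path_eval Q (\<lambda>i. path_eval Q a (\<phi> (nc_var i))) f = 0" if "assignment Q a" for a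
      using that \<open>f \<in> _\<close> by simp
    then have "path_eval Q a (\<phi> f) = 0" if "assignment Q a" for a
      using trans[OF path_eval_endomorphism[OF that \<open>algebra_endomorphism \<phi>\<close>]] that by blast
    then show ?thesis
      by blast
  qed
  then show ?thesis
    unfolding T_ideal_def poly_identities_path_algebra image_subset_iff
    by (auto simp: path_eval_mult)
qed

section \<open>The filtration by path length and products of commutators\<close>

definition long_support :: "nat \<Rightarrow> (('v, 'e) quiver_path \<Rightarrow>\<^sub>0 'f::field) \<Rightarrow> bool" where
  "long_support k f \<longleftrightarrow> (\<forall>p. path_length p < k \<longrightarrow> Poly_Mapping.lookup f p = 0)"

lemma long_support_sum:
  assumes "\<And>x. x \<in> A \<Longrightarrow> long_support k (f x)"
  shows "long_support k (sum f A)"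
  using assms by (simp add: long_support_def lookup_sum)

lemma long_support_single: "path_length p \<ge> k \<Longrightarrow> long_support k (Poly_Mapping.single p c)"
  by (auto simp: long_support_def lookup_single when_def)

lemma path_length_concat [simp]: "path_length (path_concat p q) = path_length p + path_length q"
  by (simp add: path_length_def path_concat_def split: prod.splits)

lemma long_support_path_mult:
  assumes "long_support k f" "long_support l g"
  shows "long_support (k + l) (path_mult f g)"
proof -
  have "path_length p \<ge> k" if "p \<in> Poly_Mapping.keys f" for p
    using assms(1) that by (meson in_keys_iff linorder_not_le long_support_def)
  moreover have "path_length q \<ge> l" if "q \<in> Poly_Mapping.keys g" for q
    using assms(2) that by (meson in_keys_iff linorder_not_le long_support_def)
  moreover have "long_support (k + l) 0"
    by (simp add: long_support_def)
  ultimately show ?thesis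
    unfolding path_mult_def by (auto intro!: long_support_sum long_support_single add_mono)
qed

text \<open>A product of two paths has length 0 only if both are lazy, and lazy paths
  commute.\<close>

lemma long_support_path_commutator:
  fixes f g :: "('v, 'e) quiver_path \<Rightarrow>\<^sub>0 'f::field"
  assumes "Poly_Mapping.keys f \<subseteq> quiver_paths Q" "Poly_Mapping.keys g \<subseteq> quiver_paths Q"
  shows "long_support 1 (path_mult f g - path_mult g f)"
proof -
  let ?s = "\<lambda>f p. Poly_Mapping.single p (Poly_Mapping.lookup f p)"
  have "path_mult f g - path_mult g f =
      path_mult (sum (?s f) (Poly_Mapping.keys f)) (sum (?s g) (Poly_Mapping.keys g)) -
      path_mult (sum (?s g) (Poly_Mapping.keys g)) (sum (?s f) (Poly_Mapping.keys f))"
    by (simp add: poly_mapping_sum_singles)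
  also have "\<dots> = (\<Sum>p\<in>Poly_Mapping.keys f. \<Sum>q\<in>Poly_Mapping.keys g.
      path_mult (?s f p) (?s g q) - path_mult (?s g q) (?s f p))"
    unfolding path_mult_sum_left path_mult_sum_right sum_subtractf
    by (subst (2) sum.swap) simp
  also have "long_support 1 \<dots>"
  proof (intro long_support_sum)
    fix p q
    assume "p \<in> Poly_Mapping.keys f" "q \<in> Poly_Mapping.keys g"
    then have pq: "p \<in> quiver_paths Q" "q \<in> quiver_paths Q"
      using assms by auto
    have diff: "long_support 1 (x - y)" if "long_support 1 x" "long_support 1 y"
      for x y :: "('v, 'e) quiver_path \<Rightarrow>\<^sub>0 'f"
      using that by (simp add: long_support_def lookup_minus)
    have zero: "long_support 1 (0 :: ('v, 'e) quiver_path \<Rightarrow>\<^sub>0 'f)"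
      by (simp add: long_support_def)
    show "long_support 1 (path_mult (?s f p) (?s g q) - path_mult (?s g q) (?s f p))"
    proof (cases "path_length p + path_length q = 0")
      case True
      then have "path_mult (?s f p) (?s g q) = path_mult (?s g q) (?s f p)"
        using pq by (auto simp: path_mult_single path_length_def path_concat_def path_source_def
            path_target_def quiver_paths_def Q.awalk_Nil_iff mult.commute split: prod.splits)
      then show ?thesis using zero by simp
    next
      case False
      then show ?thesis
        unfolding path_mult_single
        by (intro diff) (use zero in \<open>auto intro!: long_support_single\<close>)
    qed
  qed
  finally show ?thesis .
qed

lemma long_support_path_eval_commutators:
  assumes "assignment Q a"
  shows "long_support (length ns) (path_eval Q a (prod_list (map (\<lambda>i. commutator (b i) (c i)) ns)))"
proof (induction ns)
  case Nil
  then show ?case by (simp add: long_support_def)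
next
  case (Cons n ns)
  have "long_support 1 (path_eval Q a (commutator (b n) (c n)))"
    unfolding commutator_def path_eval_diff path_eval_mult[OF assms]
    by (rule long_support_path_commutator) (rule keys_path_eval[OF assms])+
  from long_support_path_mult[OF this Cons] show ?case
    by (simp add: path_eval_mult[OF assms])
qed

text \<open>Each commutator contributes at least one arrow, so only paths of length at least
  \<open>m\<close> could have nonzero coefficients, and \<open>Q\<close> has none.\<close>

lemma commutator_product_identity:
  assumes "\<And>p. p \<in> quiver_paths Q \<Longrightarrow> path_length p < m"
  shows "commutator_product m \<in>
    poly_identities (path_algebra Q :: ('f::field, ('v, 'e) quiver_path \<Rightarrow>\<^sub>0 'f) module)"
proof -
  have "path_eval Q a (commutator_product m) = 0" if "assignment Q a"
    for a :: "nat \<Rightarrow> ('v, 'e) quiver_path \<Rightarrow>\<^sub>0 'f"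
  proof (rule poly_mapping_eqI)
    fix p
    have "long_support m (path_eval Q a (commutator_product m))"
      unfolding commutator_product_def
      using long_support_path_eval_commutators[OF that, of "[0..<m]"] by simp
    then have "Poly_Mapping.lookup (path_eval Q a (commutator_product m)) p = 0" if "p \<in> quiver_paths Q"
      using assms[OF that] by (simp add: long_support_def del: split_paired_All)
    \<comment> \<open>Triples that are not paths of \<open>Q\<close> lie outside the support of
      every evaluation.\<close>
    moreover have "Poly_Mapping.lookup (path_eval Q a (commutator_product m)) p = 0" if "p \<notin> quiver_paths Q"
      using that keys_path_eval[OF \<open>assignment Q a\<close>, of "commutator_product m"]
      by (meson in_keys_iff subsetD)
    ultimately show "Poly_Mapping.lookup (path_eval Q a (commutator_product m)) p = Poly_Mapping.lookup 0 p"
      by auto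
  qed
  then show ?thesis
    by (simp add: poly_identities_path_algebra)
qed

section \<open>Generic combinations of lazy paths and arrows\<close>

definition lazy_arrow_element :: "('v \<Rightarrow> nat \<Rightarrow> 'f) \<Rightarrow> ('e \<Rightarrow> nat \<Rightarrow> 'f) \<Rightarrow> nat \<Rightarrow>
    (('v, 'e) quiver_path \<Rightarrow>\<^sub>0 'f::field)" where
  "lazy_arrow_element T U i = (\<Sum>v\<in>verts Q. Poly_Mapping.single (v, [], v) (T v i)) +
     (\<Sum>e\<in>arcs Q. Poly_Mapping.single (tail Q e, [e], head Q e) (U e i))"

lemma assignment_lazy_arrow_element: "assignment Q (lazy_arrow_element T U)"
  unfolding assignment_def lazy_arrow_element_def
  by (intro allI order.trans[OF keys_add] Un_least order.trans[OF keys_sum])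
    (auto simp: quiver_paths_def Q.awalk_Nil_iff Q.arc_implies_awalk split: if_splits)

lemma lookup_lazy_path_mult:
  "Poly_Mapping.lookup (path_mult (Poly_Mapping.single (u, [], u) c) g) (v, q, z) =
     (if u = v then c * Poly_Mapping.lookup g (v, q, z) else 0)"
  by (induction g rule: poly_mapping_single_induct)
    (auto simp: path_mult_single path_mult_add_right lookup_add lookup_single when_def distrib_left
      path_source_def path_target_def path_concat_def split: prod.splits)

lemma lookup_arrow_path_mult:
  "Poly_Mapping.lookup (path_mult (Poly_Mapping.single (x, [e], y) c) g) (v, q, z) =
     (if q \<noteq> [] \<and> e = hd q \<and> x = v then c * Poly_Mapping.lookup g (y, tl q, z) else 0)"
  by (induction g rule: poly_mapping_single_induct)
    (auto simp: path_mult_single path_mult_add_right lookup_add lookup_single when_def distrib_left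
      path_source_def path_target_def path_concat_def split: prod.splits)

text \<open>A left factor \<open>lazy_arrow_element T U i\<close> can produce a path from
  \<open>v\<close> through the lazy path at \<open>v\<close> or through the first arrow of the path.
  These are the two terms in the recursion of \<open>walk_weight\<close>.\<close>

lemma lookup_path_word:
  assumes "pre_digraph.awalk Q v p z"
  shows "Poly_Mapping.lookup (path_word Q (lazy_arrow_element T U) w) (v, p, z) =
    walk_weight (head Q) T U v p w"
  using assms
proof (induction w arbitrary: v p)
  case Nil
  then show ?case
    by (cases p) (auto simp: lookup_sum lookup_single when_def Q.awalk_Nil_iff)
next
  case (Cons i w)
  let ?g = "path_word Q (lazy_arrow_element T U) w"
  have v: "v \<in> verts Q" using Cons.prems by auto
  have "Poly_Mapping.lookup (path_word Q (lazy_arrow_element T U) (i # w)) (v, p, z) =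
     (\<Sum>u\<in>verts Q. if u = v then T u i * Poly_Mapping.lookup ?g (v, p, z) else 0) +
     (\<Sum>e\<in>arcs Q. if p \<noteq> [] \<and> e = hd p \<and> tail Q e = v
        then U e i * Poly_Mapping.lookup ?g (head Q e, tl p, z) else 0)"
    by (simp add: lazy_arrow_element_def path_mult_add_left path_mult_sum_left lookup_add lookup_sum
        lookup_lazy_path_mult lookup_arrow_path_mult)
  also have "(\<Sum>u\<in>verts Q. if u = v then T u i * Poly_Mapping.lookup ?g (v, p, z) else 0) =
      T v i * walk_weight (head Q) T U v p w"
    using v Cons by simp
  finally have *: "Poly_Mapping.lookup (path_word Q (lazy_arrow_element T U) (i # w)) (v, p, z) = \<dots> +
      (\<Sum>e\<in>arcs Q. if p \<noteq> [] \<and> e = hd p \<and> tail Q e = v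
        then U e i * Poly_Mapping.lookup ?g (head Q e, tl p, z) else 0)" .
  show ?case
  proof (cases p)
    case Nil
    then show ?thesis using * by simp
  next
    case p: (Cons e p')
    then have e: "e \<in> arcs Q" "tail Q e = v" "pre_digraph.awalk Q (head Q e) p' z"
      using Cons.prems by (auto simp: Q.awalk_Cons_iff)
    have "(\<Sum>e'\<in>arcs Q. if p \<noteq> [] \<and> e' = hd p \<and> tail Q e' = v
        then U e' i * Poly_Mapping.lookup ?g (head Q e', tl p, z) else 0) =
        (\<Sum>e'\<in>arcs Q. if e' = e then U e i * Poly_Mapping.lookup ?g (head Q e, p', z) else 0)"
      using e p by (intro sum.cong) auto
    also have "\<dots> = U e i * walk_weight (head Q) T U (head Q e) p' w"
      using e Cons.IH by simp
    finally show ?thesis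
      using * p by simp
  qed
qed

text \<open>If the head of an arrow \<open>e'\<close> on the walk were \<open>v\<close>, the walk up
  to and including \<open>e'\<close> would be a closed path of positive length.\<close>

lemma acyclic_quiver_distinct:
  assumes "acyclic_quiver Q" "pre_digraph.awalk Q v p z"
  shows "distinct (v # map (head Q) p)"
  using assms(2)
proof (induction p arbitrary: v)
  case (Cons e p)
  have "v \<noteq> head Q e'" if e': "e' \<in> set (e # p)" for e'
  proof
    assume "v = head Q e'"
    obtain p1 p2 where "e # p = p1 @ e' # p2"
      using split_list[OF e'] by blast
    then have "pre_digraph.awalk Q v ((p1 @ [e']) @ p2) z"
      using Cons.prems by simp
    then obtain x where "pre_digraph.awalk Q v (p1 @ [e']) x"
      by (simp only: Q.awalk_append_iff) blast
    moreover from this have "x = head Q e'"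
      by (auto simp: Q.awalk_append_iff Q.awalk_Cons_iff Q.awalk_Nil_iff)
    ultimately have "(v, p1 @ [e'], v) \<in> quiver_paths Q"
      using \<open>v = head Q e'\<close> by (simp add: quiver_paths_def)
    then show False
      using assms(1) by (force simp: acyclic_quiver_def path_length_def path_source_def path_target_def)
  qed
  then show ?case
    using Cons by (auto simp: Q.awalk_Cons_iff)
qed simp

text \<open>The walk weights along initial segments of \<open>p\<close> are coefficients of an
  evaluation of \<open>f\<close>, hence 0. Since \<open>I\<close> contains every product of
  \<open>Suc (length p)\<close> commutators, that many quotients exhaust the free algebra.\<close>

lemma path_identity_mem_T_ideal:
  fixes f :: "'f::field_char_0 free_algebra"
  assumes "acyclic_quiver Q" "pre_digraph.awalk Q v p z"
    and f: "f \<in> poly_identities (path_algebra Q :: ('f, ('v, 'e) quiver_path \<Rightarrow>\<^sub>0 'f) module)"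
    and I: "T_ideal I" "commutator_product (Suc (length p)) \<in> I"
  shows "f \<in> I"
proof (rule mem_left_ideal_if_walk_weights)
  show left: "left_ideal_set I"
    using I(1) by (auto simp: T_ideal_def left_ideal_set_def)
  show "(commutator_quotient ^^ Suc (length p)) I = UNIV"
    using T_ideal_commutator_prods[OF I] I(1)
    by (intro funpow_commutator_quotient_UNIV left) (auto simp: T_ideal_def)
  show "distinct (v # map (head Q) p)"
    by (rule acyclic_quiver_distinct[OF assms(1,2)])
  fix T U k
  \<comment> \<open>Initial segments of \<open>p\<close> are walks too, so
    \<open>lookup_path_word\<close> applies with their end vertex \<open>x\<close>.\<close>
  have "pre_digraph.awalk Q v (take k p @ drop k p) z"
    using assms(2) by simp
  then obtain x where x: "pre_digraph.awalk Q v (take k p) x"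
    by (simp only: Q.awalk_append_iff) blast
  have "word_sum (walk_weight (head Q) T U v (take k p)) f =
      Poly_Mapping.lookup (path_eval Q (lazy_arrow_element T U) f) (v, take k p, x)"
    by (simp add: word_sum_def path_eval_def lookup_sum lookup_map_scale lookup_path_word[OF x])
  also have "\<dots> = 0"
    using f assignment_lazy_arrow_element[of T U] by (simp add: poly_identities_path_algebra)
  finally show "word_sum (walk_weight (head Q) T U v (take k p)) f = 0" .
qed

end

theorem theorem1p2:
  fixes Q :: "('v, 'e) pre_digraph" and m :: nat
  assumes "fin_digraph Q"
    and "acyclic_quiver Q"
    and "m \<ge> 1"
    and "is_max_path_length Q (m - 1)"
  shows "poly_identities (path_algebra Q :: ('f::field_char_0, ('v, 'e) quiver_path \<Rightarrow>\<^sub>0 'f) module) =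
         T_ideal_generated {commutator_product m}"
proof
  let ?Id = "poly_identities (path_algebra Q :: ('f, ('v, 'e) quiver_path \<Rightarrow>\<^sub>0 'f) module)"
  \<comment> \<open>A path of maximal length: \<open>Suc (length p)\<close> equals \<open>m\<close>
    because \<open>m\<close> is positive.\<close>
  obtain v p z where p: "pre_digraph.awalk Q v p z" "length p = m - 1"
    using assms(4) by (auto simp: is_max_path_length_def quiver_paths_def path_length_def)
  show "?Id \<subseteq> T_ideal_generated {commutator_product m}"
    using path_identity_mem_T_ideal[OF assms(1,2) p(1)] p(2) assms(3)
    by (auto simp: T_ideal_generated_def)
  have "path_length q < m" if "q \<in> quiver_paths Q" for q
    using assms(3,4) that by (fastforce simp: is_max_path_length_def)
  then have "commutator_product m \<in> ?Id"
    by (rule commutator_product_identity[OF assms(1)])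
  then show "T_ideal_generated {commutator_product m} \<subseteq> ?Id"
    using T_ideal_poly_identities[OF assms(1)] unfolding T_ideal_generated_def by (intro Inter_lower) simp
qed

end
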